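(* Let $G$ be a fixed matrix with rows $g_\ell^\top$ and let $\mathcal S_0=\{0\}$ and, for $t=1,\dots,H$, $$\mathcal S_t=\mathcal S_t(\alpha_t)=\{e\in\mathbb R^n: Ge\le\alpha_t\}$$ be compact polytopic tube cross-sections. The tube is shift-compatible, i.e. $$A_K^j\mathcal S_1\oplus\mathcal S_j\subseteq\mathcal S_{j+1},\qquad j=0,\dots,H-1,$$ if, for every $j=0,\dots,H-1$ and every row $g_\ell^\top$ of $G$, $$h_{\mathcal S_1}\big((A_K^j)^\top g_\ell\big)+h_{\mathcal S_j}(g_\ell)\le\alpha_{j+1,\ell},$$ where $h_{\mathcal S_0}\equiv0$.
   Context: $A_K\in\mathbb R^{n\times n}$ is the closed-loop error matrix $A+BK$ for a fixed gain $K$. $h_S(a):=\sup_{s\in S}a^\top s$ is the support function of $S$; $\oplus$ is Minkowski sum; $\alpha_{t,\ell}$ is the $\ell$-th entry of $\alpha_t$; the inequality $Ge\le\alpha_t$ is componentwise. *)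

theory Defs
  imports "HOL-Analysis.Analysis"
begin

definition closed_loop :: "real^'n^'n \<Rightarrow> real^'u^'n \<Rightarrow> real^'n^'u \<Rightarrow> real^'n^'n" where
  "closed_loop A B K = A + B ** K"

(* Powers with respect to the matrix product. Multiplication on the vec type is
   componentwise, so (^) on real^'n^'n would not denote the matrix power. *)
primrec mat_power :: "real^'n^'n \<Rightarrow> nat \<Rightarrow> real^'n^'n" where
  "mat_power M 0 = mat 1"
| "mat_power M (Suc j) = M ** mat_power M j"

(* The supremum is taken in the extended reals, so that it is the true supremum for every S
   (plus infinity when unbounded, minus infinity for the empty set). *)
definition support_function :: "(real^'n) set \<Rightarrow> real^'n \<Rightarrow> ereal" where
  "support_function S a = (SUP s\<in>S. ereal (a \<bullet> s))"

lemma support_function_zero: "support_function {0} a = 0"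
  by (simp add: support_function_def)

(* The order on real^'m is componentwise (less_eq_vec_def). *)
definition tube_section :: "real^'n^'m \<Rightarrow> (nat \<Rightarrow> real^'m) \<Rightarrow> nat \<Rightarrow> (real^'n) set" where
  "tube_section G \<alpha> t = (if t = 0 then {0} else {e. G *v e \<le> \<alpha> t})"

(* The sum of two sets is the Minkowski sum (set_plus_def). *)
definition shift_compatible :: "real^'n^'n \<Rightarrow> (nat \<Rightarrow> (real^'n) set) \<Rightarrow> nat \<Rightarrow> bool" where
  "shift_compatible M S H \<longleftrightarrow>
     (\<forall>j<H. (\<lambda>e. mat_power M j *v e) ` S 1 + S j \<subseteq> S (j + 1))"

end

theory Submission
  imports Defs
begin

text \<open>Membership in a polyhedral section can be tested one row at a time. For z = A_K^j x + y
  with x in S_1 and y in S_j, moving A_K^j across the inner product splits g_l . z into ((A_K^j)^T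
  g_l) . x + g_l . y. By \<open>inner_le_support_function\<close> each term is at most the
  corresponding support function, and the assumed inequality bounds their sum by the l-th entry of
  \<alpha>_{j+1}.\<close>

lemma inner_le_support_function: "x \<in> S \<Longrightarrow> ereal (a \<bullet> x) \<le> support_function S a"
  unfolding support_function_def by (rule SUP_upper)

theorem proposition16:
  fixes A :: "real^'n^'n" and B :: "real^'u^'n" and K :: "real^'n^'u"
    and G :: "real^'n^'m" and \<alpha> :: "nat \<Rightarrow> real^'m" and H :: nat
  defines "A\<^sub>K \<equiv> closed_loop A B K"
    and "S \<equiv> tube_section G \<alpha>"
  assumes "\<And>t. t \<in> {1..H} \<Longrightarrow> compact (S t)"
    and "\<And>j l. j < H \<Longrightarrow>
           support_function (S 1) (transpose (mat_power A\<^sub>K j) *v row l G)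
             + support_function (S j) (row l G) \<le> ereal (\<alpha> (j + 1) $ l)"
  shows "shift_compatible A\<^sub>K S H"
  unfolding shift_compatible_def
proof (intro allI impI subsetI)
  fix j z
  assume "j < H" and "z \<in> (\<lambda>e. mat_power A\<^sub>K j *v e) ` S 1 + S j"
  then obtain x y where x: "x \<in> S 1" and y: "y \<in> S j" and z: "z = mat_power A\<^sub>K j *v x + y"
    by (auto simp: set_plus_def)
  have "(G *v z) $ l \<le> \<alpha> (j + 1) $ l" for l
  proof -
    let ?a = "transpose (mat_power A\<^sub>K j) *v row l G"
    have "(G *v z) $ l = ?a \<bullet> x + row l G \<bullet> y"
      by (simp add: z matrix_vector_mul_component row_def inner_add_right
          dot_lmul_matrix transpose_matrix_vector)
    \<comment> \<open>The real sum is split into a sum in \<open>ereal\<close>, where addition is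
      monotone, infinite values included, so the two bounds add.\<close>
    also have "ereal \<dots> \<le> support_function (S 1) ?a + support_function (S j) (row l G)"
      unfolding plus_ereal.simps(1)[symmetric]
      by (intro add_mono inner_le_support_function x y)
    also have "\<dots> \<le> ereal (\<alpha> (j + 1) $ l)"
      using assms(4) \<open>j < H\<close> .
    finally show ?thesis by simp
  qed
  \<comment> \<open>The index j + 1 is nonzero, so the target is always a polyhedron; the section
    {0} occurs only as the summand \<open>S j\<close> at j = 0.\<close>
  then show "z \<in> S (j + 1)"
    by (simp add: S_def tube_section_def less_eq_vec_def)
qed

end
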